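(* Let $f:\Omega\times\mathbb{R}\to\mathbb{R}$ be a Carathéodory function satisfying the growth condition $$|f(x,t)|\le C(1+|t|^{q-1})\quad\text{for a.e. }x\in\Omega\text{ and all }t\in\mathbb{R},$$ for some $C>0$ and $q\in[1,2_s^*]$. Then every weak solution $u\in X(\Omega)$ of the problem $L_Ku=f(x,u)$ in $\Omega$, $u=0$ in $\mathbb{R}^n\setminus\Omega$, belongs to $L^\infty(\Omega)$. Moreover, if $q<2_s^*$, there exists a function $M\in C(\mathbb{R}_+)$, depending only on $C,n,s,\Omega$ (and the kernel $K$), such that every such weak solution satisfies $\|u\|_{L^\infty(\Omega)}\le M(\|u\|_{L^{2_s^*}(\Omega)})$.
   Context: Standing assumptions: $s\in(0,1)$, $n>2s$, $\Omega\subset\mathbb{R}^n$ is a bounded domain with $C^{1,1}$ boundary, $2_s^*=2n/(n-2s)$. The kernel is $K(y)=a(y/|y|)|y|^{-(n+2s)}$ for $y\neq0$, with $a\in L^1(S^{n-1})$ even and $\inf_{S^{n-1}}a>0$. The space $X(\Omega)=\{u\in L^2(\mathbb{R}^n):\ \int_{\mathbb{R}^{2n}}|u(x)-u(y)|^2K(x-y)\,dx\,dy<\infty,\ u=0\text{ a.e. in }\mathbb{R}^n\setminus\Omega\}$ is a Hilbert space with inner product $\langle u,v\rangle=\int_{\mathbb{R}^{2n}}(u(x)-u(y))(v(x)-v(y))K(x-y)\,dx\,dy$ and norm $\|u\|=\langle u,u\rangle^{1/2}$. A weak solution of $L_Ku=f(x,u)$ in $\Omega$, $u=0$ in $\mathbb{R}^n\setminus\Omega$,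 is $u\in X(\Omega)$ with $\langle u,v\rangle=\int_\Omega f(x,u(x))v(x)\,dx$ for all $v\in X(\Omega)$.
   Formalization: The function M is allowed to depend on q as well as on C, n, s, Ω and K; no M independent of q can exist, since on a ball least-energy solutions with f = t_+^{q-1} blow up in L^∞ with bounded L^{2_s^*} norm as q → 2_s^*. *)

theory Defs
  imports "HOL-Analysis.Analysis"
begin

definition crit_exp :: "nat \<Rightarrow> real \<Rightarrow> real" where
  "crit_exp n s = 2 * real n / (real n - 2 * s)"

text \<open>Power with the convention $0^0 = 1$ (Isabelle's powr has 0 powr 0 = 0).\<close>
definition pow0 :: "real \<Rightarrow> real \<Rightarrow> real" where
  "pow0 x p = (if x = 0 then (if p = 0 then 1 else 0) else x powr p)"

text \<open>Bounded domain with $C^{1,1}$ boundary: near every boundary point, after choosing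
  a unit direction e, the domain is the supergraph over the hyperplane orthogonal to e of
  a $C^1$ function with Lipschitz gradient.\<close>
definition C11_boundary :: "'a::euclidean_space set \<Rightarrow> bool" where
  "C11_boundary \<Omega> \<longleftrightarrow>
     (\<forall>x0\<in>frontier \<Omega>. \<exists>r>0. \<exists>e g g'. norm e = 1 \<and>
        (\<forall>x. (g has_derivative (\<lambda>h. g' x \<bullet> h)) (at x)) \<and>
        (\<exists>L. \<forall>x y. norm (g' x - g' y) \<le> L * norm (x - y)) \<and>
        \<Omega> \<inter> ball x0 r = {x \<in> ball x0 r. g (x - (x \<bullet> e) *\<^sub>R e) < x \<bullet> e})"

text \<open>Surface measure on the unit sphere (cone construction:
  sigma(A) = n * Lebesgue measure of the cone over A inside the unit ball).\<close>
definition sphere_measure :: "'a::euclidean_space measure" where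
  "sphere_measure = density
     (distr (restrict_space lborel (ball 0 1 - {0})) borel (\<lambda>y. y /\<^sub>R norm y))
     (\<lambda>_. ennreal (real DIM('a)))"

definition admissible_kernel :: "('a::euclidean_space \<Rightarrow> real) \<Rightarrow> bool" where
  "admissible_kernel a \<longleftrightarrow>
     integrable sphere_measure a \<and>
     (\<forall>\<omega>\<in>sphere 0 1. a (- \<omega>) = a \<omega>) \<and>
     (\<exists>c>0. \<forall>\<omega>\<in>sphere 0 1. c \<le> a \<omega>)"

definition kernelK :: "('a::euclidean_space \<Rightarrow> real) \<Rightarrow> real \<Rightarrow> 'a \<Rightarrow> real" where
  "kernelK a s y = a (y /\<^sub>R norm y) / norm y powr (real DIM('a) + 2 * s)"

definition Xspace :: "('a::euclidean_space \<Rightarrow> real) \<Rightarrow> real \<Rightarrow> 'a set \<Rightarrow> ('a \<Rightarrow> real) set" where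
  "Xspace a s \<Omega> = {u. u \<in> borel_measurable lborel \<and>
      integrable lborel (\<lambda>x. (u x)\<^sup>2) \<and>
      integrable (lborel \<Otimes>\<^sub>M lborel) (\<lambda>p. (u (fst p) - u (snd p))\<^sup>2 * kernelK a s (fst p - snd p)) \<and>
      (AE x in lborel. x \<notin> \<Omega> \<longrightarrow> u x = 0)}"

definition innerX :: "('a::euclidean_space \<Rightarrow> real) \<Rightarrow> real \<Rightarrow> ('a \<Rightarrow> real) \<Rightarrow> ('a \<Rightarrow> real) \<Rightarrow> real" where
  "innerX a s u v = integral\<^sup>L (lborel \<Otimes>\<^sub>M lborel)
      (\<lambda>p. (u (fst p) - u (snd p)) * (v (fst p) - v (snd p)) * kernelK a s (fst p - snd p))"

definition weak_solution ::
  "('a::euclidean_space \<Rightarrow> real) \<Rightarrow> real \<Rightarrow> 'a set \<Rightarrow> ('a \<Rightarrow> real \<Rightarrow> real) \<Rightarrow> ('a \<Rightarrow> real) \<Rightarrow> bool" where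
  "weak_solution a s \<Omega> f u \<longleftrightarrow> u \<in> Xspace a s \<Omega> \<and>
     (\<forall>v\<in>Xspace a s \<Omega>. innerX a s u v = integral\<^sup>L (lebesgue_on \<Omega>) (\<lambda>x. f x (u x) * v x))"

definition caratheodory :: "'a::euclidean_space set \<Rightarrow> ('a \<Rightarrow> real \<Rightarrow> real) \<Rightarrow> bool" where
  "caratheodory \<Omega> f \<longleftrightarrow>
     (\<forall>t. (\<lambda>x. f x t) \<in> borel_measurable (lebesgue_on \<Omega>)) \<and>
     (AE x in lebesgue_on \<Omega>. continuous_on UNIV (f x))"

definition growth_bound :: "'a::euclidean_space set \<Rightarrow> ('a \<Rightarrow> real \<Rightarrow> real) \<Rightarrow> real \<Rightarrow> real \<Rightarrow> bool" where
  "growth_bound \<Omega> f C q \<longleftrightarrow>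
     (AE x in lebesgue_on \<Omega>. \<forall>t. \<bar>f x t\<bar> \<le> C * (1 + pow0 \<bar>t\<bar> (q - 1)))"

definition Lp_norm_on :: "'a::euclidean_space set \<Rightarrow> real \<Rightarrow> ('a \<Rightarrow> real) \<Rightarrow> real" where
  "Lp_norm_on \<Omega> p u = (integral\<^sup>L (lebesgue_on \<Omega>) (\<lambda>x. \<bar>u x\<bar> powr p)) powr (1 / p)"

end

theory Submission
  imports Defs
begin

text \<open>
  The fractional Sobolev inequality comes from a pointwise estimate: with \<open>p = 2\<^sub>s\<^sup>*\<close> and
  \<open>P = \<integral>\<bar>u\<bar>\<^sup>p\<close>, Chebyshev's inequality on a ball of volume comparable to \<open>P / \<bar>u x\<bar>\<^sup>p\<close> gives
  \<open>\<bar>u x\<bar>\<^sup>p \<le> A P\<^bsup>2s/n\<^esup> \<integral> (u x - u y)\<^sup>2 K (x - y) dy\<close>, and integrating in \<open>x\<close> yields \<open>P\<^bsup>2/p\<^esup> \<le> A \<langle>u, u\<rangle>\<close>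
  whenever \<open>P\<close> is finite; truncation removes that restriction.

  Boundedness is a De Giorgi iteration. Testing the equation with \<open>(u - m)\<^sup>+\<close> and comparing consecutive
  levels \<open>k (2 - 2\<^sup>-\<^sup>j)\<close>, the quantities \<open>U\<^sub>j = \<integral> ((u - k (2 - 2\<^sup>-\<^sup>j))\<^sup>+)\<^sup>p\<close> satisfy
  \<open>U\<^sub>j\<^sub>+\<^sub>1 \<le> (c k\<^bsup>q-p\<^esup>)\<^bsup>p/2\<^esup> D\<^sup>j U\<^sub>j\<^bsup>p/2\<^esup>\<close>, so that \<open>U\<^sub>j \<rightarrow> 0\<close>, and hence \<open>u \<le> 2 k\<close>, as soon as
  \<open>k\<^bsup>(q-p)p/2\<^esup> U\<^sub>0\<^bsup>p/2-1\<^esup>\<close> is small. In the critical case this holds for large \<open>k\<close> because \<open>U\<^sub>0 \<rightarrow> 0\<close>; in the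
  subcritical case the negative power of \<open>k\<close> gives an explicit threshold in terms of \<open>\<parallel>u\<parallel>\<^sub>p\<close>.
\<close>

section \<open>Critical exponent and kernel bounds\<close>

text \<open>The second identity balances the powers of \<open>\<bar>u x\<bar>\<close> in the
  pointwise Sobolev estimate; the third gives the exponent left after dividing \<open>P\<close> by
  \<open>P powr (2 * s / n)\<close>.\<close>

lemma crit_exp_identities:
  assumes "0 < s" "2 * s < real n"
  shows "2 < crit_exp n s"
    and "2 + crit_exp n s * (2 * s / n) = crit_exp n s"
    and "1 - 2 * s / n = 2 / crit_exp n s"
proof -
  have "0 < n" using assms by (cases n) auto
  then show "2 < crit_exp n s" "2 + crit_exp n s * (2 * s / n) = crit_exp n s"
    "1 - 2 * s / n = 2 / crit_exp n s"
    using assms by (auto simp: crit_exp_def field_simps)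
qed

text \<open>\<open>sphere_measure\<close> is an image measure on the Borel sets of the whole space,
  so integrability against it carries Borel measurability everywhere, also off the sphere.\<close>

lemma admissible_kernel_measurable:
  assumes "admissible_kernel a"
  shows "a \<in> borel_measurable borel"
proof -
  have "a \<in> borel_measurable (sphere_measure :: 'a measure)"
    using assms unfolding admissible_kernel_def by auto
  moreover have "sets (sphere_measure :: 'a measure) = sets borel"
    by (simp add: sphere_measure_def)
  ultimately show ?thesis
    using measurable_cong_sets by blast
qed

lemma kernelK_measurable:
  assumes "admissible_kernel a"
  shows "kernelK a s \<in> borel_measurable borel"
proof -
  have [measurable]: "a \<in> borel_measurable borel"
    by (rule admissible_kernel_measurable[OF assms])
  show ?thesis
    unfolding kernelK_def by measurable
qed

lemma kernelK_lower_bound: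
  fixes a :: "'a::euclidean_space \<Rightarrow> real"
  assumes "admissible_kernel a"
  obtains c where "0 < c"
    "\<And>y. y \<noteq> 0 \<Longrightarrow> c * norm y powr - (real DIM('a) + 2 * s) \<le> kernelK a s y"
proof -
  obtain c where c: "0 < c" "\<And>\<omega>. \<omega> \<in> sphere 0 1 \<Longrightarrow> c \<le> a \<omega>"
    using assms unfolding admissible_kernel_def by auto
  show ?thesis
  proof
    fix y :: 'a
    assume "y \<noteq> 0"
    then have "c \<le> a (y /\<^sub>R norm y)"
      by (intro c) simp
    then show "c * norm y powr - (real DIM('a) + 2 * s) \<le> kernelK a s y"
      unfolding kernelK_def powr_minus_divide by (simp add: divide_right_mono)
  qed (rule c)
qed

lemma kernelK_nonneg:
  assumes "admissible_kernel a"
  shows "0 \<le> kernelK a s y"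
proof (cases "y = 0")
  case False
  then have "0 \<le> a (y /\<^sub>R norm y)"
    using assms unfolding admissible_kernel_def
    by (metis dual_order.trans less_imp_le norm_sgn mem_sphere_0 sgn_div_norm)
  then show ?thesis
    by (simp add: kernelK_def)
\<comment> \<open>At the origin the kernel is 0, since \<open>0 powr _\<close> and division by 0 are
  0.\<close>
qed (simp add: kernelK_def)

section \<open>Fractional Sobolev inequality\<close>

text \<open>The radius is chosen so that, by Chebyshev's inequality, \<open>\<bar>u\<bar> \<le> \<bar>u x\<bar> / 2\<close> on at least half of the
  ball around \<open>x\<close>; on that half the integrand is bounded below.\<close>

lemma powr_crit_exp_le_nonlocal_gradient:
  fixes u K :: "'a::euclidean_space \<Rightarrow> real"
  assumes s: "0 < s" "2 * s < real DIM('a)"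
    and c: "0 < c" "\<And>y. y \<noteq> 0 \<Longrightarrow> c * norm y powr - (real DIM('a) + 2 * s) \<le> K y"
    and u [measurable]: "u \<in> borel_measurable borel"
    and int: "integrable lborel (\<lambda>y. \<bar>u y\<bar> powr crit_exp DIM('a) s)"
    and pos: "0 < (\<integral>y. \<bar>u y\<bar> powr crit_exp DIM('a) s \<partial>lborel)"
    and K [measurable]: "K \<in> borel_measurable borel"
  defines "p \<equiv> crit_exp DIM('a) s"
  defines "\<omega> \<equiv> unit_ball_vol (real DIM('a))"
  defines "A \<equiv> 8 / (c * \<omega>) * (2 / \<omega> * 2 powr p) powr (2 * s / DIM('a))"
  shows "ennreal (\<bar>u x\<bar> powr p) \<le>
    ennreal (A * (\<integral>y. \<bar>u y\<bar> powr p \<partial>lborel) powr (2 * s / DIM('a))) *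
    (\<integral>\<^sup>+y. ennreal ((u x - u y)\<^sup>2 * K (x - y)) \<partial>lborel)"
proof (cases "u x = 0")
  case False
  define h where "h = \<bar>u x\<bar>"
  define P where "P = (\<integral>y. \<bar>u y\<bar> powr p \<partial>lborel)"
  let ?n = "real DIM('a)"
  define \<sigma> where "\<sigma> = 2 * s / ?n"
  \<comment> \<open>The ball of this radius has volume \<open>2 * (2 / h) powr p * P\<close>, twice
    the Chebyshev bound for the set \<open>T\<close> where \<open>\<bar>u\<bar>\<close> is at least
    \<open>h / 2\<close>.\<close>
  define r where "r = (2 / \<omega> * (2 / h) powr p * P) powr (1 / ?n)"
  have h: "0 < h" using False by (simp add: h_def)
  have P: "0 < P" using pos by (simp add: P_def p_def)
  have p: "2 < p" "2 + p * \<sigma> = p"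
    using crit_exp_identities[OF s] by (simp_all add: p_def \<sigma>_def)
  have \<omega>: "0 < \<omega>" by (simp add: \<omega>_def)
  have n: "0 < ?n" by simp
  have r: "0 < r" using h P \<omega> by (simp add: r_def)
  have rn: "r ^ DIM('a) = 2 / \<omega> * (2 / h) powr p * P"
  proof -
    have "r ^ DIM('a) = r powr ?n" using r by (simp add: powr_realpow)
    also have "\<dots> = 2 / \<omega> * (2 / h) powr p * P"
      using h P \<omega> by (simp add: r_def powr_powr)
    finally show ?thesis .
  qed
  define T where "T = {y \<in> space lborel. (h / 2) powr p \<le> \<bar>u y\<bar> powr p}"
  define B where "B = ball x r - T"
  have T [measurable]: "T \<in> sets borel" unfolding T_def by measurable
  have B [measurable]: "B \<in> sets borel" unfolding B_def by measurable
  have "emeasure lborel T \<le> ennreal (1 / (h / 2) powr p * P)"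
    unfolding T_def P_def
    by (rule integral_Markov_inequality) (use int h in \<open>auto simp: p_def\<close>)
  then have emT: "emeasure lborel T < \<infinity>"
    by (simp add: le_less_trans)
  have "measure lborel T \<le> P / (h / 2) powr p"
    unfolding T_def P_def
    by (rule integral_Markov_inequality_measure[of lborel _ "{}"]) (use int h in \<open>auto simp: p_def\<close>)
  also have "\<dots> = \<omega> * r ^ DIM('a) / 2"
    using h \<omega> by (simp add: rn powr_divide field_simps)
  finally have mT: "measure lborel T \<le> \<omega> * r ^ DIM('a) / 2" .
  have fin: "emeasure lborel (ball x r) < \<infinity>"
    using r by (simp add: emeasure_ball)
  have finB: "emeasure lborel B < \<infinity>"
    by (rule le_less_trans[OF emeasure_mono fin]) (auto simp: B_def)
  \<comment> \<open>The ball is covered by \<open>B\<close> and \<open>T\<close>, and the measure of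
    \<open>T\<close> is at most half that of the ball, so \<open>B\<close> keeps the other
    half.\<close>
  have "measure lborel (ball x r) \<le> measure lborel (B \<union> T)"
    using finB emT by (intro measure_mono_fmeasurable fmeasurable.Un fmeasurableI)
      (auto simp: B_def)
  also have "\<dots> \<le> measure lborel B + measure lborel T"
    using fin emT by (intro measure_Un_le) auto
  finally have mB: "\<omega> * r ^ DIM('a) / 2 \<le> measure lborel B"
    using mT r by (simp add: content_ball \<omega>_def)
  have emB: "emeasure lborel B = ennreal (measure lborel B)"
    using finB by (intro emeasure_eq_ennreal_measure) auto
  \<comment> \<open>On \<open>B\<close> the difference \<open>\<bar>u x - u y\<bar>\<close> is at
    least \<open>h / 2\<close> and the distance is below \<open>r\<close>; \<open>D\<close> is the
    resulting lower bound for the integrand.\<close>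
  define D where "D = h\<^sup>2 / 4 * (c * r powr - (?n + 2 * s))"
  have D: "0 < D" using h c r by (simp add: D_def)
  have ptw: "ennreal D * indicator B y \<le> ennreal ((u x - u y)\<^sup>2 * K (x - y))" for y
  proof (cases "y \<in> B")
    case True
    then have dist: "dist x y < r" and "\<bar>u y\<bar> powr p < (h / 2) powr p"
      by (auto simp: B_def T_def)
    then have le: "\<bar>u y\<bar> < h / 2"
      using h p by (metis abs_ge_zero half_gt_zero less_imp_le not_le powr_mono2 order.trans zero_le_numeral)
    then have "x \<noteq> y" using h by (auto simp: h_def)
    then have xy: "0 < norm (x - y)" by simp
    have "(h / 2)\<^sup>2 \<le> (u x - u y)\<^sup>2"
      using le h unfolding abs_le_square_iff[symmetric] h_def by linarith
    moreover have "c * r powr - (?n + 2 * s) \<le> K (x - y)"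
    proof -
      have "r powr - (?n + 2 * s) \<le> norm (x - y) powr - (?n + 2 * s)"
        using xy dist s by (intro powr_mono2') (auto simp: dist_norm)
      then have "c * r powr - (?n + 2 * s) \<le> c * norm (x - y) powr - (?n + 2 * s)"
        using c(1) by simp
      also have "\<dots> \<le> K (x - y)" using xy by (intro c) auto
      finally show ?thesis .
    qed
    ultimately have "D \<le> (u x - u y)\<^sup>2 * K (x - y)"
      unfolding D_def using c(1) r by (intro mult_mono) (auto simp: power_divide)
    then show ?thesis using True by (simp add: ennreal_leI)
  qed simp
  have "ennreal (D * (\<omega> * r ^ DIM('a) / 2)) \<le> ennreal D * emeasure lborel B"
    unfolding emB using D mB by (simp add: ennreal_mult'[symmetric] ennreal_leI)
  also have "\<dots> = (\<integral>\<^sup>+y. ennreal D * indicator B y \<partial>lborel)"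
    by (simp add: nn_integral_cmult_indicator)
  also have "\<dots> \<le> (\<integral>\<^sup>+y. ennreal ((u x - u y)\<^sup>2 * K (x - y)) \<partial>lborel)"
    by (intro nn_integral_mono ptw)
  finally have low: "ennreal (D * (\<omega> * r ^ DIM('a) / 2))
      \<le> (\<integral>\<^sup>+y. ennreal ((u x - u y)\<^sup>2 * K (x - y)) \<partial>lborel)" .
  \<comment> \<open>With this constant \<open>r ^ n = Z * P * h powr - p\<close>. The only power of
    \<open>r\<close> left in \<open>D\<close> times the volume is \<open>r powr - (2 * s)\<close>;
    it contributes \<open>h powr (p * \<sigma>)\<close>, which completes \<open>h\<^sup>2\<close> to
    \<open>h powr p\<close>.\<close>
  define Z where "Z = 2 / \<omega> * 2 powr p"
  have Z: "0 < Z" using \<omega> by (simp add: Z_def)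
  have "r powr - (?n + 2 * s) * r ^ DIM('a) = r powr - (2 * s)"
  proof -
    have "r ^ DIM('a) = r powr ?n" using r by (simp add: powr_realpow)
    then show ?thesis by (simp add: powr_add[symmetric])
  qed
  also have "\<dots> = (Z * P * h powr - p) powr - \<sigma>"
    using h by (simp add: r_def powr_powr \<sigma>_def Z_def powr_divide powr_minus_divide)
  also have "\<dots> = (Z * P) powr - \<sigma> * h powr (p * \<sigma>)"
    using h Z P by (simp add: powr_mult powr_powr)
  finally have rr: "r powr - (?n + 2 * s) * r ^ DIM('a) = (Z * P) powr - \<sigma> * h powr (p * \<sigma>)" .
  have "h powr p = h\<^sup>2 * h powr (p * \<sigma>)"
    using h by (simp add: powr_add[symmetric] powr_numeral[symmetric] p(2) del: powr_numeral)
  also have "\<dots> = h\<^sup>2 * ((Z * P) powr \<sigma> * ((Z * P) powr - \<sigma> * h powr (p * \<sigma>)))"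
    using Z P by (simp add: powr_minus)
  also have "\<dots> = (8 / (c * \<omega>) * (Z * P) powr \<sigma>) * (D * (\<omega> * r ^ DIM('a) / 2))"
    unfolding D_def rr[symmetric] using c(1) \<omega> by (simp add: field_simps)
  also have "8 / (c * \<omega>) * (Z * P) powr \<sigma> = A * P powr \<sigma>"
    unfolding A_def Z_def[symmetric] \<sigma>_def[symmetric] using Z P by (simp add: powr_mult)
  finally have "ennreal (h powr p) = ennreal (A * P powr \<sigma>) * ennreal (D * (\<omega> * r ^ DIM('a) / 2))"
    using c \<omega> by (simp add: ennreal_mult'[symmetric] A_def)
  also have "\<dots> \<le> ennreal (A * P powr \<sigma>) * (\<integral>\<^sup>+y. ennreal ((u x - u y)\<^sup>2 * K (x - y)) \<partial>lborel)"
    by (intro mult_left_mono low) simp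
  finally show ?thesis by (simp add: h_def P_def \<sigma>_def)
qed simp

text \<open>Integrating the pointwise estimate gives \<open>P \<le> A * P powr \<sigma> * E\<close>
  with \<open>\<sigma> = 2 * s / n\<close>. Cancelling \<open>P powr \<sigma>\<close> calls for a
  finite integral, hence the integrability assumption.\<close>

lemma sobolev_of_integrable:
  fixes u K :: "'a::euclidean_space \<Rightarrow> real"
  assumes s: "0 < s" "2 * s < real DIM('a)"
    and c: "0 < c" "\<And>y. y \<noteq> 0 \<Longrightarrow> c * norm y powr - (real DIM('a) + 2 * s) \<le> K y"
    and u [measurable]: "u \<in> borel_measurable borel"
    and int: "integrable lborel (\<lambda>y. \<bar>u y\<bar> powr crit_exp DIM('a) s)"
    and K [measurable]: "K \<in> borel_measurable borel" and K_nonneg: "\<And>y. 0 \<le> K y"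
    and energy: "integrable (lborel \<Otimes>\<^sub>M lborel)
      (\<lambda>z. (u (fst z) - u (snd z))\<^sup>2 * K (fst z - snd z))"
  defines "p \<equiv> crit_exp DIM('a) s"
  defines "\<omega> \<equiv> unit_ball_vol (real DIM('a))"
  defines "A \<equiv> 8 / (c * \<omega>) * (2 / \<omega> * 2 powr p) powr (2 * s / DIM('a))"
  shows "(\<integral>y. \<bar>u y\<bar> powr p \<partial>lborel) powr (2 / p) \<le>
    A * (\<integral>z. (u (fst z) - u (snd z))\<^sup>2 * K (fst z - snd z) \<partial>(lborel \<Otimes>\<^sub>M lborel))"
proof -
  define P where "P = (\<integral>y. \<bar>u y\<bar> powr p \<partial>lborel)"
  define E where "E = (\<integral>z. (u (fst z) - u (snd z))\<^sup>2 * K (fst z - snd z) \<partial>(lborel \<Otimes>\<^sub>M lborel))"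
  define \<sigma> where "\<sigma> = 2 * s / real DIM('a)"
  have \<omega>: "0 < \<omega>" by (simp add: \<omega>_def)
  have A: "0 \<le> A" using c \<omega> by (simp add: A_def)
  have E: "0 \<le> E" unfolding E_def by (intro Bochner_Integration.integral_nonneg) (simp add: K_nonneg)
  have P: "0 \<le> P" unfolding P_def by simp
  have "P powr (2 / p) \<le> A * E"
  proof (cases "P = 0")
    case False
    with P have P: "0 < P" by simp
    let ?G = "\<lambda>x. \<integral>\<^sup>+y. ennreal ((u x - u y)\<^sup>2 * K (x - y)) \<partial>lborel"
    have [measurable]: "?G \<in> borel_measurable lborel" by measurable
    have "ennreal P = (\<integral>\<^sup>+x. ennreal (\<bar>u x\<bar> powr p) \<partial>lborel)"
      unfolding P_def p_def by (intro nn_integral_eq_integral[symmetric] int) simp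
    also have "\<dots> \<le> (\<integral>\<^sup>+x. ennreal (A * P powr \<sigma>) * ?G x \<partial>lborel)"
      unfolding P_def A_def \<omega>_def \<sigma>_def p_def
      by (intro nn_integral_mono
          powr_crit_exp_le_nonlocal_gradient[OF s c u int P[unfolded P_def p_def] K])
    also have "\<dots> = ennreal (A * P powr \<sigma>) * (\<integral>\<^sup>+x. ?G x \<partial>lborel)"
      by (intro nn_integral_cmult) measurable
    also have "(\<integral>\<^sup>+x. ?G x \<partial>lborel) =
        (\<integral>\<^sup>+z. ennreal ((u (fst z) - u (snd z))\<^sup>2 * K (fst z - snd z)) \<partial>(lborel \<Otimes>\<^sub>M lborel))"
      by (subst lborel.nn_integral_fst[symmetric]) auto
    also have "\<dots> = ennreal E"
      unfolding E_def by (intro nn_integral_eq_integral energy) (simp add: K_nonneg)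
    also have "ennreal (A * P powr \<sigma>) * ennreal E = ennreal (A * P powr \<sigma> * E)"
      using A E by (simp add: ennreal_mult)
    finally have "P \<le> A * P powr \<sigma> * E"
      using A E by (simp add: ennreal_le_iff)
    then have "P powr (1 - \<sigma>) \<le> A * E"
      using P by (simp add: powr_diff field_simps)
    then show ?thesis
      using crit_exp_identities(3)[OF s] by (simp add: \<sigma>_def p_def)
  qed (use A E in simp)
  then show ?thesis by (simp add: P_def E_def)
qed

section \<open>Energy space: contractions and embedding\<close>

lemma XspaceD:
  assumes "u \<in> Xspace a s \<Omega>"
  shows "u \<in> borel_measurable borel"
    and "integrable lborel (\<lambda>x. (u x)\<^sup>2)"
    and "integrable (lborel \<Otimes>\<^sub>M lborel) (\<lambda>p. (u (fst p) - u (snd p))\<^sup>2 * kernelK a s (fst p - snd p))"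
    and "AE x in lborel. x \<notin> \<Omega> \<longrightarrow> u x = 0"
  using assms unfolding Xspace_def by auto

lemma innerX_self:
  "innerX a s u u = (\<integral>p. (u (fst p) - u (snd p))\<^sup>2 * kernelK a s (fst p - snd p) \<partial>(lborel \<Otimes>\<^sub>M lborel))"
  by (simp add: innerX_def power2_eq_square)

text \<open>A 1-Lipschitz map shrinks every difference \<open>u x - u y\<close>; fixing 0, it also
  shrinks \<open>\<bar>u\<bar>\<close> and keeps the zero values outside the domain. Truncations and
  excesses \<open>max 0 (u x - m)\<close> are the cases of interest.\<close>

lemma Xspace_contraction:
  assumes a: "admissible_kernel a" and u: "u \<in> Xspace a s \<Omega>"
    and \<phi> [measurable]: "\<phi> \<in> borel_measurable borel" and "\<phi> 0 = 0"
    and lip: "\<And>t t'. \<bar>\<phi> t - \<phi> t'\<bar> \<le> \<bar>t - t'\<bar>"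
  shows "(\<lambda>x. \<phi> (u x)) \<in> Xspace a s \<Omega>"
    and "innerX a s (\<lambda>x. \<phi> (u x)) (\<lambda>x. \<phi> (u x)) \<le> innerX a s u u"
proof -
  note [measurable] = XspaceD(1)[OF u] kernelK_measurable[OF a]
  have le: "(\<phi> t - \<phi> t')\<^sup>2 * kernelK a s z \<le> (t - t')\<^sup>2 * kernelK a s z" for t t' z
    using lip by (intro mult_right_mono kernelK_nonneg[OF a]) (simp add: abs_le_square_iff)
  have sq: "(\<phi> t)\<^sup>2 \<le> t\<^sup>2" for t
    using lip[of t 0] \<open>\<phi> 0 = 0\<close> by (simp add: abs_le_square_iff)
  have int: "integrable (lborel \<Otimes>\<^sub>M lborel)
      (\<lambda>p. (\<phi> (u (fst p)) - \<phi> (u (snd p)))\<^sup>2 * kernelK a s (fst p - snd p))"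
    by (rule Bochner_Integration.integrable_bound[OF XspaceD(3)[OF u]])
      (auto intro!: AE_I2 simp: abs_mult kernelK_nonneg[OF a] le)
  show "(\<lambda>x. \<phi> (u x)) \<in> Xspace a s \<Omega>"
    unfolding Xspace_def
  proof (intro CollectI conjI int)
    show "integrable lborel (\<lambda>x. (\<phi> (u x))\<^sup>2)"
      by (rule Bochner_Integration.integrable_bound[OF XspaceD(2)[OF u]]) (auto simp: sq)
    show "AE x in lborel. x \<notin> \<Omega> \<longrightarrow> \<phi> (u x) = 0"
      using XspaceD(4)[OF u] by eventually_elim (auto simp: \<open>\<phi> 0 = 0\<close>)
  qed measurable
  show "innerX a s (\<lambda>x. \<phi> (u x)) (\<lambda>x. \<phi> (u x)) \<le> innerX a s u u"
    unfolding innerX_self by (intro integral_mono int XspaceD(3)[OF u] le)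
qed

text \<open>For a nondecreasing contraction, \<open>(\<phi> t - \<phi> t')\<^sup>2 \<le> (t - t') *
  (\<phi> t - \<phi> t')\<close> holds pointwise. Testing the equation with
  \<open>\<phi> (u x)\<close> therefore controls the energy of that test function itself.\<close>

lemma innerX_mono_contraction:
  assumes a: "admissible_kernel a" and u: "u \<in> Xspace a s \<Omega>"
    and \<phi> [measurable]: "\<phi> \<in> borel_measurable borel" and "\<phi> 0 = 0"
    and lip: "\<And>t t'. \<bar>\<phi> t - \<phi> t'\<bar> \<le> \<bar>t - t'\<bar>" and "mono \<phi>"
  shows "innerX a s (\<lambda>x. \<phi> (u x)) (\<lambda>x. \<phi> (u x)) \<le> innerX a s u (\<lambda>x. \<phi> (u x))"
proof -
  note [measurable] = XspaceD(1)[OF u] kernelK_measurable[OF a]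
  have eq: "(t - t') * (\<phi> t - \<phi> t') = \<bar>t - t'\<bar> * \<bar>\<phi> t - \<phi> t'\<bar>" for t t'
    using \<open>mono \<phi>\<close>[THEN monoD, of t t'] \<open>mono \<phi>\<close>[THEN monoD, of t' t]
    by (cases "t \<le> t'") (auto simp: abs_if algebra_simps)
  have le1: "(\<phi> t - \<phi> t')\<^sup>2 \<le> (t - t') * (\<phi> t - \<phi> t')" for t t'
    unfolding eq power2_abs[of "\<phi> t - \<phi> t'", symmetric] unfolding power2_eq_square
    by (intro mult_right_mono lip) simp
  \<comment> \<open>The energy density of \<open>u\<close> dominates the mixed one, which makes the
    mixed integrand integrable.\<close>
  have le2: "\<bar>(t - t') * (\<phi> t - \<phi> t')\<bar> \<le> (t - t')\<^sup>2" for t t'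
    unfolding abs_mult power2_abs[of "t - t'", symmetric] unfolding power2_eq_square
    by (intro mult_left_mono lip) simp
  have "integrable (lborel \<Otimes>\<^sub>M lborel)
      (\<lambda>p. (u (fst p) - u (snd p)) * (\<phi> (u (fst p)) - \<phi> (u (snd p))) * kernelK a s (fst p - snd p))"
    by (rule Bochner_Integration.integrable_bound[OF XspaceD(3)[OF u]], measurable)
      (auto intro!: AE_I2 mult_right_mono simp: abs_mult[of _ "kernelK _ _ _"] kernelK_nonneg[OF a] le2)
  then show ?thesis
    unfolding innerX_self unfolding innerX_def
    by (intro integral_mono XspaceD(3)[OF Xspace_contraction(1)[OF a u \<phi> \<open>\<phi> 0 = 0\<close> lip]])
      (auto intro!: mult_right_mono le1 kernelK_nonneg[OF a])
qed

text \<open>Truncations of \<open>u\<close> are bounded and square integrable, hence in L^p, and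
  their energies are at most that of \<open>u\<close>. The inequality for integrable functions then
  bounds their L^p integrals uniformly in the height, and Fatou's lemma gives integrability for
  \<open>u\<close>. The constant comes from \<open>s\<close>, the dimension and the kernel
  alone.\<close>

lemma Xspace_sobolev:
  fixes a :: "'a::euclidean_space \<Rightarrow> real"
  assumes s: "0 < s" "2 * s < real DIM('a)" and a: "admissible_kernel a"
  obtains A where "0 < A"
    "\<And>u. u \<in> Xspace a s \<Omega> \<Longrightarrow> integrable lborel (\<lambda>x. \<bar>u x\<bar> powr crit_exp DIM('a) s)"
    "\<And>u. u \<in> Xspace a s \<Omega> \<Longrightarrow>
      (\<integral>x. \<bar>u x\<bar> powr crit_exp DIM('a) s \<partial>lborel) powr (2 / crit_exp DIM('a) s) \<le> A * innerX a s u u"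
proof -
  define p where "p = crit_exp DIM('a) s"
  have p: "2 < p" using crit_exp_identities(1)[OF s] by (simp add: p_def)
  obtain c where c: "0 < c"
    "\<And>y::'a. y \<noteq> 0 \<Longrightarrow> c * norm y powr - (real DIM('a) + 2 * s) \<le> kernelK a s y"
    using kernelK_lower_bound[OF a] by blast
  define \<omega> where "\<omega> = unit_ball_vol (real DIM('a))"
  define A where "A = 8 / (c * \<omega>) * (2 / \<omega> * 2 powr p) powr (2 * s / DIM('a))"
  have \<omega>: "0 < \<omega>" by (simp add: \<omega>_def)
  have A: "0 < A" using c \<omega> by (simp add: A_def)
  have *: "(\<integral>x. \<bar>u x\<bar> powr p \<partial>lborel) powr (2 / p) \<le> A * innerX a s u u"
    if "u \<in> Xspace a s \<Omega>" "integrable lborel (\<lambda>x. \<bar>u x\<bar> powr p)" for u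
    using sobolev_of_integrable[OF s c XspaceD(1)[OF that(1)] that(2)[unfolded p_def]
        kernelK_measurable[OF a] kernelK_nonneg[OF a] XspaceD(3)[OF that(1)]]
    by (simp add: innerX_self p_def A_def \<omega>_def)
  have int: "integrable lborel (\<lambda>x. \<bar>u x\<bar> powr p)" if u: "u \<in> Xspace a s \<Omega>" for u
  proof -
    note [measurable] = XspaceD(1)[OF u]
    define \<phi> :: "nat \<Rightarrow> real \<Rightarrow> real" where "\<phi> m t = max (- real m) (min (real m) t)" for m t
    have [measurable]: "\<phi> m \<in> borel_measurable borel" for m
      unfolding \<phi>_def by measurable
    have \<phi>0: "\<phi> m 0 = 0" and lip: "\<bar>\<phi> m t - \<phi> m t'\<bar> \<le> \<bar>t - t'\<bar>" for m t t'
      by (auto simp: \<phi>_def)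
    have \<phi>X: "(\<lambda>x. \<phi> m (u x)) \<in> Xspace a s \<Omega>"
      and \<phi>E: "innerX a s (\<lambda>x. \<phi> m (u x)) (\<lambda>x. \<phi> m (u x)) \<le> innerX a s u u" for m
      using Xspace_contraction[OF a u _ \<phi>0 lip] by auto
    have bound: "\<bar>\<phi> m t\<bar> powr p \<le> real m powr (p - 2) * t\<^sup>2" for m t
    proof (cases "\<phi> m t = 0")
      case False
      have "\<bar>\<phi> m t\<bar> powr p = \<bar>\<phi> m t\<bar> powr (p - 2) * \<bar>\<phi> m t\<bar> powr 2"
        using powr_add[of "\<bar>\<phi> m t\<bar>" "p - 2" 2] by simp
      also have "\<dots> = \<bar>\<phi> m t\<bar> powr (p - 2) * (\<phi> m t)\<^sup>2"
        using False by simp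
      also have "\<dots> \<le> real m powr (p - 2) * t\<^sup>2"
        using p lip[of m t 0] by (intro mult_mono powr_mono2) (auto simp: \<phi>0 abs_le_square_iff, auto simp: \<phi>_def)
      finally show ?thesis .
    qed (use p in simp)
    have \<phi>int: "integrable lborel (\<lambda>x. \<bar>\<phi> m (u x)\<bar> powr p)" for m
      by (rule Bochner_Integration.integrable_bound[OF integrable_mult_right[OF XspaceD(2)[OF u], of "real m powr (p - 2)"]])
        (auto intro!: AE_I2 bound simp: abs_mult)
    define R where "R = (A * innerX a s u u) powr (p / 2)"
    have le: "(\<integral>x. \<bar>\<phi> m (u x)\<bar> powr p \<partial>lborel) \<le> R" for m
    proof -
      let ?P = "\<integral>x. \<bar>\<phi> m (u x)\<bar> powr p \<partial>lborel"
      have "?P = (?P powr (2 / p)) powr (p / 2)"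
        using p by (simp add: powr_powr)
      also have "\<dots> \<le> R"
        unfolding R_def
        using p A by (intro powr_mono2 order.trans[OF *[OF \<phi>X \<phi>int]] mult_left_mono \<phi>E) auto
      finally show ?thesis .
    qed
    have lim: "(\<lambda>m. ennreal (\<bar>\<phi> m (u x)\<bar> powr p)) \<longlonglongrightarrow> ennreal (\<bar>u x\<bar> powr p)" for x
    proof (rule tendsto_eventually)
      show "\<forall>\<^sub>F m in sequentially. ennreal (\<bar>\<phi> m (u x)\<bar> powr p) = ennreal (\<bar>u x\<bar> powr p)"
        using eventually_ge_at_top[of "nat \<lceil>\<bar>u x\<bar>\<rceil>"]
      proof eventually_elim
        case (elim m)
        then have "\<bar>u x\<bar> \<le> real m" by linarith
        then have "\<phi> m (u x) = u x" by (auto simp: \<phi>_def)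
        then show ?case by simp
      qed
    qed
    have "(\<integral>\<^sup>+x. ennreal (\<bar>u x\<bar> powr p) \<partial>lborel) =
        (\<integral>\<^sup>+x. liminf (\<lambda>m. ennreal (\<bar>\<phi> m (u x)\<bar> powr p)) \<partial>lborel)"
      using lim_imp_Liminf[OF sequentially_bot lim] by simp
    also have "\<dots> \<le> liminf (\<lambda>m. \<integral>\<^sup>+x. ennreal (\<bar>\<phi> m (u x)\<bar> powr p) \<partial>lborel)"
      by (rule nn_integral_liminf) measurable
    also have "\<dots> = liminf (\<lambda>m. ennreal (\<integral>x. \<bar>\<phi> m (u x)\<bar> powr p \<partial>lborel))"
      by (subst nn_integral_eq_integral[OF \<phi>int]) auto
    also have "\<dots> \<le> liminf (\<lambda>m. ennreal R)"
      by (intro Liminf_mono always_eventually allI ennreal_leI le)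
    also have "\<dots> < \<infinity>"
      by (simp add: Liminf_const)
    finally show ?thesis
      by (intro integrableI_bounded) auto
  qed
  show thesis
    by (rule that[OF A]) (auto simp: p_def[symmetric] intro: int * )
qed

section \<open>Energy above a level\<close>

text \<open>The right-hand side of the equation is integrated over
  \<open>lebesgue_on \<Omega>\<close>, the energy space uses \<open>lborel\<close>; this inequality
  passes from the first to the second.\<close>

lemma lebesgue_on_integral_le:
  fixes f g :: "'a::euclidean_space \<Rightarrow> real"
  assumes \<Omega>: "\<Omega> \<in> sets lebesgue" and g: "integrable lborel g" "\<And>x. 0 \<le> g x"
    and le: "AE x in lebesgue_on \<Omega>. f x \<le> g x"
  shows "(\<integral>x. f x \<partial>lebesgue_on \<Omega>) \<le> (\<integral>x. g x \<partial>lborel)"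
proof -
  have gL: "integrable lebesgue g"
    using g(1) by (simp add: integrable_completion)
  have ind: "integrable lebesgue (\<lambda>x. indicator \<Omega> x *\<^sub>R g x)"
    by (rule integrable_mult_indicator[OF \<Omega> gL])
  have gO: "integrable (lebesgue_on \<Omega>) g"
    using \<Omega> ind by (subst integrable_restrict_space) auto
  have "(\<integral>x. f x \<partial>lebesgue_on \<Omega>) \<le> (\<integral>x. g x \<partial>lebesgue_on \<Omega>)"
  proof (cases "integrable (lebesgue_on \<Omega>) f")
    case True
    then show ?thesis by (intro integral_mono_AE gO le)
  next
    \<comment> \<open>By convention the integral of \<open>f\<close> is then 0, and \<open>g\<close>
      is nonnegative.\<close>
    case False
    then show ?thesis using g(2) by (simp add: not_integrable_integral_eq)
  qed
  also have "\<dots> = (\<integral>x. indicator \<Omega> x *\<^sub>R g x \<partial>lebesgue)"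
    using \<Omega> by (subst integral_restrict_space) auto
  also have "\<dots> \<le> (\<integral>x. g x \<partial>lebesgue)"
    using g(2) by (intro integral_mono ind gL) (auto simp: indicator_def)
  also have "\<dots> = (\<integral>x. g x \<partial>lborel)"
    using g(1) by (intro integral_completion) auto
  finally show ?thesis .
qed

text \<open>Above the level \<open>m\<close> the gap \<open>w = t - l\<close> is at least
  \<open>m - l\<close>, so \<open>t\<close> and \<open>t - m\<close> are at most multiples of
  \<open>w\<close>. The resulting \<open>w powr q\<close> becomes \<open>w powr p\<close> at the
  price of \<open>(m - l) powr (q - p)\<close>, as \<open>q \<le> p\<close>.\<close>

lemma growth_bound_on_level_set:
  assumes C: "0 < C" and q: "1 \<le> q" "q \<le> p" and lm: "1 \<le> l" "l < m"
    and growth: "\<And>t. \<bar>g t\<bar> \<le> C * (1 + pow0 \<bar>t\<bar> (q - 1))"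
  shows "g t * max 0 (t - m) \<le>
    2 * C * (m / (m - l)) powr (q - 1) * (m - l) powr (q - p) * max 0 (t - l) powr p"
proof (cases "m < t")
  case True
  define w where "w = t - l"
  have w: "m - l \<le> w" "0 < w" "0 \<le> w" "t - m \<le> w" "1 \<le> t" "0 < t"
    using True lm by (auto simp: w_def)
  \<comment> \<open>The ratio \<open>t / w = 1 + l / w\<close> is largest at the smallest gap
    \<open>w = m - l\<close>, where it equals \<open>m / (m - l)\<close>.\<close>
  have "t \<le> m / (m - l) * w"
  proof -
    have "l * (m - l) \<le> l * w" using w lm by (intro mult_left_mono) auto
    then have "t * (m - l) \<le> m * w" by (simp add: w_def algebra_simps)
    then show ?thesis using lm by (simp add: field_simps)
  qed
  then have t: "t powr (q - 1) \<le> (m / (m - l)) powr (q - 1) * w powr (q - 1)"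
    unfolding powr_mult[symmetric] using q w by (intro powr_mono2) auto
  \<comment> \<open>As \<open>t \<ge> 1\<close>, the constant term of the growth bound is absorbed
    into the power, which gives the factor 2.\<close>
  have "C \<le> C * t powr (q - 1)" using w q C by (simp add: ge_one_powr_ge_zero)
  moreover have "pow0 \<bar>t\<bar> (q - 1) = t powr (q - 1)" using w by (simp add: pow0_def)
  ultimately have "g t \<le> 2 * C * t powr (q - 1)"
    using growth[of t] by (auto simp: distrib_left)
  also have "\<dots> \<le> 2 * C * ((m / (m - l)) powr (q - 1) * w powr (q - 1))"
    using t C by simp
  finally have "g t * (t - m) \<le> 2 * C * ((m / (m - l)) powr (q - 1) * w powr (q - 1)) * w"
    using True w C by (intro mult_mono) auto
  also have "\<dots> = 2 * C * (m / (m - l)) powr (q - 1) * (w powr (q - p) * w powr p)"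
    using w by (simp add: powr_add[symmetric] powr_mult_base mult.commute[of _ w])
  also have "\<dots> \<le> 2 * C * (m / (m - l)) powr (q - 1) * ((m - l) powr (q - p) * w powr p)"
    using w q lm C by (intro mult_left_mono mult_right_mono powr_mono2') auto
  finally show ?thesis using True w by (simp add: w_def mult.assoc max_def)
qed (use C lm in \<open>auto simp: max_def\<close>)

text \<open>A Caccioppoli-type estimate. Testing with the excess over \<open>m\<close> bounds its
  energy by the integral of \<open>f\<close> times that excess, and the L^p mass above the lower
  level \<open>l\<close> controls this integral pointwise under the integral sign.\<close>

lemma excess_energy_le:
  fixes a :: "'a::euclidean_space \<Rightarrow> real"
  assumes a: "admissible_kernel a" and "open \<Omega>" and C: "0 < C" and q: "1 \<le> q" "q \<le> p"
    and growth: "growth_bound \<Omega> f C q" and weak: "weak_solution a s \<Omega> f u"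
    and lm: "1 \<le> l" "l < m"
    and int: "integrable lborel (\<lambda>x. max 0 (u x - l) powr p)"
  shows "innerX a s (\<lambda>x. max 0 (u x - m)) (\<lambda>x. max 0 (u x - m)) \<le>
    2 * C * (m / (m - l)) powr (q - 1) * (m - l) powr (q - p) *
    (\<integral>x. max 0 (u x - l) powr p \<partial>lborel)"
proof -
  define D where "D = 2 * C * (m / (m - l)) powr (q - 1) * (m - l) powr (q - p)"
  have u: "u \<in> Xspace a s \<Omega>" using weak by (simp add: weak_solution_def)
  define \<phi> where "\<phi> t = max 0 (t - m)" for t :: real
  have \<phi>: "\<phi> \<in> borel_measurable borel" "\<phi> 0 = 0" "\<And>t t'. \<bar>\<phi> t - \<phi> t'\<bar> \<le> \<bar>t - t'\<bar>" "mono \<phi>"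
    using lm unfolding \<phi>_def by (auto intro!: monoI)
  have "innerX a s (\<lambda>x. \<phi> (u x)) (\<lambda>x. \<phi> (u x)) \<le> innerX a s u (\<lambda>x. \<phi> (u x))"
    by (rule innerX_mono_contraction[OF a u \<phi>])
  also have "\<dots> = (\<integral>x. f x (u x) * \<phi> (u x) \<partial>lebesgue_on \<Omega>)"
    using weak Xspace_contraction(1)[OF a u \<phi>(1-3)] by (simp add: weak_solution_def)
  also have "\<dots> \<le> (\<integral>x. D * max 0 (u x - l) powr p \<partial>lborel)"
  proof (rule lebesgue_on_integral_le)
    show "\<Omega> \<in> sets lebesgue" using \<open>open \<Omega>\<close> by simp
    show "AE x in lebesgue_on \<Omega>. f x (u x) * \<phi> (u x) \<le> D * max 0 (u x - l) powr p"
      using growth unfolding growth_bound_def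
    proof eventually_elim
      case (elim x)
      then show ?case
        unfolding D_def \<phi>_def by (intro growth_bound_on_level_set C q lm) auto
    qed
  qed (use int C in \<open>auto simp: D_def\<close>)
  finally show ?thesis by (simp add: \<phi>_def D_def)
qed

section \<open>De Giorgi iteration\<close>

text \<open>A superlinear recursion beats the geometric factor \<open>D ^ j\<close> once the start
  is small: the induction shows \<open>U j \<le> U 0 * \<rho> ^ j\<close>.\<close>

lemma fast_geometric_decay:
  fixes U :: "nat \<Rightarrow> real"
  assumes U: "\<And>j. 0 \<le> U j" and \<delta>: "0 < \<delta>" and A: "0 \<le> A" and D: "1 < D"
    and step: "\<And>j. U (Suc j) \<le> A * D ^ j * U j powr (1 + \<delta>)"
    and small: "A * U 0 powr \<delta> * D powr (1 / \<delta>) \<le> 1"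
  shows "U \<longlonglongrightarrow> 0"
proof -
  \<comment> \<open>This ratio satisfies \<open>\<rho> powr \<delta> = 1 / D\<close>, so the surplus
    power of \<open>\<rho> ^ j\<close> cancels \<open>D ^ j\<close>; the smallness assumption says
    \<open>A * U 0 powr \<delta> \<le> \<rho>\<close>, which supplies the next factor.\<close>
  define \<rho> where "\<rho> = D powr - (1 / \<delta>)"
  have \<rho>: "0 < \<rho>" "\<rho> < 1" using D \<delta> by (auto simp: \<rho>_def powr_minus powr_less_one inverse_less_1_iff)
  have "U j \<le> U 0 * \<rho> ^ j" for j
  proof (induction j)
    case (Suc j)
    have "U (Suc j) \<le> A * D ^ j * U j powr (1 + \<delta>)" by (rule step)
    also have "\<dots> \<le> A * D ^ j * (U 0 * \<rho> ^ j) powr (1 + \<delta>)"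
      using A D \<delta> U Suc by (intro mult_left_mono powr_mono2) auto
    also have "\<dots> = A * D ^ j * (U 0 powr (1 + \<delta>) * (\<rho> ^ j) powr (1 + \<delta>))"
      using U \<rho> by (simp add: powr_mult)
    also have "(\<rho> ^ j) powr (1 + \<delta>) = \<rho> ^ j * (\<rho> powr \<delta>) ^ j"
      using \<rho> by (simp add: powr_add powr_realpow[symmetric] powr_powr mult.commute)
    also have "\<rho> powr \<delta> = 1 / D"
      unfolding \<rho>_def powr_powr using D \<delta> by (simp add: powr_minus_divide)
    also have "A * D ^ j * (U 0 powr (1 + \<delta>) * (\<rho> ^ j * (1 / D) ^ j)) = A * U 0 powr (1 + \<delta>) * \<rho> ^ j"
      using D by (simp add: power_divide)
    also have "\<dots> = (A * U 0 powr \<delta>) * (U 0 * \<rho> ^ j)"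
      using U[of 0] by (simp add: powr_add)
    also have "\<dots> \<le> \<rho> * (U 0 * \<rho> ^ j)"
    proof (rule mult_right_mono)
      show "A * U 0 powr \<delta> \<le> \<rho>"
        using small D by (simp add: \<rho>_def powr_minus_divide field_simps)
    qed (use U \<rho> in simp)
    finally show ?case by (simp add: mult_ac)
  qed simp
  moreover have "(\<lambda>j. U 0 * \<rho> ^ j) \<longlonglongrightarrow> 0"
    using \<rho> by (intro tendsto_mult_right_zero LIMSEQ_realpow_zero) auto
  ultimately show ?thesis
    using U by (intro tendsto_sandwich[of "\<lambda>_. 0" U sequentially "\<lambda>j. U 0 * \<rho> ^ j"]) auto
qed

text \<open>\<open>\<Theta>\<close> is chosen before \<open>f\<close>, \<open>u\<close> and
  \<open>k\<close>; this uniformity is what yields a single function \<open>M\<close> in the end.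
  The iteration runs over levels rising from \<open>k\<close> towards \<open>2 * k\<close>.\<close>

lemma weak_solution_le_of_small_excess:
  fixes \<Omega> :: "'a::euclidean_space set" and a :: "'a \<Rightarrow> real"
  assumes s: "0 < s" "2 * s < real DIM('a)" and "open \<Omega>" and a: "admissible_kernel a"
    and C: "0 < C" and q: "1 \<le> q" "q \<le> crit_exp DIM('a) s"
  defines "p \<equiv> crit_exp DIM('a) s"
  obtains \<Theta> where "0 < \<Theta>"
    "\<And>f u k. \<lbrakk>growth_bound \<Omega> f C q; weak_solution a s \<Omega> f u; 1 \<le> k;
      \<Theta> * k powr (p / 2 * (q - p)) * (\<integral>x. max 0 (u x - k) powr p \<partial>lborel) powr (p / 2 - 1) \<le> 1\<rbrakk>
      \<Longrightarrow> AE x in lborel. u x \<le> 2 * k"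
proof -
  obtain A where A: "0 < A"
    and sob_int: "\<And>u. u \<in> Xspace a s \<Omega> \<Longrightarrow> integrable lborel (\<lambda>x. \<bar>u x\<bar> powr p)"
    and sob: "\<And>u. u \<in> Xspace a s \<Omega> \<Longrightarrow>
      (\<integral>x. \<bar>u x\<bar> powr p \<partial>lborel) powr (2 / p) \<le> A * innerX a s u u"
    using Xspace_sobolev[OF s a, where \<Omega> = \<Omega>] unfolding p_def by metis
  have p: "2 < p" using crit_exp_identities(1)[OF s] by (simp add: p_def)
  have qp: "q \<le> p" using q by (simp add: p_def)
  define \<delta> where "\<delta> = p / 2 - 1"
  have \<delta>: "0 < \<delta>" "1 + \<delta> = p / 2" using p by (auto simp: \<delta>_def)
  \<comment> \<open>Product of the Sobolev constant, the factor \<open>2 * C\<close> of the level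
    estimate and the part of \<open>b powr p * b powr p\<close> independent of \<open>j\<close>;
    \<open>D\<close> comes from the rest of it, raised to \<open>p / 2\<close>.\<close>
  define c where "c = A * 2 * C * 16 powr p"
  have c: "0 < c" using A C by (simp add: c_def)
  define D where "D = (4 powr p) powr (p / 2)"
  have D: "1 < D" using p by (simp add: D_def powr_powr gr_one_powr)
  \<comment> \<open>The constant in the starting condition of the geometric decay, with the power of
    \<open>k\<close> split off.\<close>
  define \<Theta> where "\<Theta> = c powr (p / 2) * D powr (1 / \<delta>)"
  have "AE x in lborel. u x \<le> 2 * k"
    if growth: "growth_bound \<Omega> f C q" and weak: "weak_solution a s \<Omega> f u" and k: "1 \<le> k"
      and small: "\<Theta> * k powr (p / 2 * (q - p)) * (\<integral>x. max 0 (u x - k) powr p \<partial>lborel) powr \<delta> \<le> 1"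
    for f u k
  proof -
    have u: "u \<in> Xspace a s \<Omega>" using weak by (simp add: weak_solution_def)
    note [measurable] = XspaceD(1)[OF u]
    define l where "l j = k * (2 - (1 / 2) ^ j)" for j :: nat
    have l1: "1 \<le> l j" "l j \<le> 2 * k" for j
    proof -
      have "(1 / 2 :: real) ^ j \<le> 1" by (simp add: power_le_one)
      then have "1 * 1 \<le> k * (2 - (1 / 2) ^ j)" using k by (intro mult_mono) auto
      then show "1 \<le> l j" by (simp add: l_def)
      show "l j \<le> 2 * k" using k by (simp add: l_def)
    qed
    have l_diff: "l (Suc j) - l j = k * (1 / 2) ^ Suc j" for j
      by (simp add: l_def field_simps)
    have l_less: "l j < l (Suc j)" for j
      using l_diff[of j] k by (smt (verit) zero_less_power mult_pos_pos half_gt_zero)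
    have excess_X: "(\<lambda>x. max 0 (u x - m)) \<in> Xspace a s \<Omega>" if "1 \<le> m" for m
      by (rule Xspace_contraction(1)[OF a u, of "\<lambda>t. max 0 (t - m)"]) (use that in auto)
    have excess_int: "integrable lborel (\<lambda>x. max 0 (u x - m) powr p)" if "1 \<le> m" for m
      using sob_int[OF excess_X[OF that]] by simp
    define U where "U j = (\<integral>x. max 0 (u x - l j) powr p \<partial>lborel)" for j
    have U: "0 \<le> U j" for j by (simp add: U_def)
    have step: "U (Suc j) \<le> (c * k powr (q - p)) powr (p / 2) * D ^ j * U j powr (1 + \<delta>)" for j
    proof -
      define m where "m = l (Suc j)"
      define d where "d = m - l j"
      \<comment> \<open>This is \<open>2 * k / d\<close>, a bound for \<open>m / d\<close>; it also
        exceeds \<open>k / d = 2 ^ Suc j\<close>.\<close>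
      define b where "b = (2::real) ^ (j + 2)"
      have d: "d = k * (1 / 2) ^ Suc j" "0 < d"
        using l_diff[of j] l_less[of j] by (auto simp: d_def m_def)
      have b: "1 \<le> b" unfolding b_def by (rule one_le_power) simp
      have "m / d \<le> 2 * k / d"
        using l1 d by (intro divide_right_mono) (auto simp: m_def)
      also have "\<dots> = b" using k by (simp add: d b_def field_simps)
      finally have "m / d \<le> b" .
      moreover have "0 < m" using l1[of "Suc j"] by (simp add: m_def)
      ultimately have "(m / d) powr (q - 1) \<le> b powr (q - 1)"
        using d(2) q by (intro powr_mono2) auto
      also have "\<dots> \<le> b powr p" using b qp by (intro powr_mono) auto
      finally have md: "(m / d) powr (q - 1) \<le> b powr p" .
      \<comment> \<open>The factor \<open>k powr (q - p)\<close> is kept apart: for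
        \<open>q < p\<close> it is the gain that large \<open>k\<close> brings.\<close>
      have "d powr (q - p) = (k / 2 ^ Suc j) powr (q - p)"
        unfolding d(1) by (simp add: power_one_over)
      also have "\<dots> = k powr (q - p) * (2 ^ Suc j) powr - (q - p)"
        by (simp only: powr_divide powr_minus_divide times_divide_eq_right mult_1_right)
      also have "\<dots> = k powr (q - p) * (2 ^ Suc j) powr (p - q)"
        by (simp only: minus_diff_eq)
      also have "\<dots> \<le> k powr (q - p) * b powr (p - q)"
        using qp by (intro mult_left_mono powr_mono2) (auto simp: b_def)
      also have "\<dots> \<le> k powr (q - p) * b powr p"
        using b q by (intro mult_left_mono powr_mono) auto
      finally have dq: "d powr (q - p) \<le> k powr (q - p) * b powr p" .
      have bb: "b powr p * b powr p = 16 powr p * (4 powr p) ^ j"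
      proof -
        have "b * b = 16 * 4 ^ j"
          by (simp add: b_def power_add power_mult_distrib[symmetric])
        moreover have "((4::real) ^ j) powr p = (4 powr p) ^ j"
          by (simp add: powr_realpow[symmetric] powr_powr mult.commute)
        ultimately show ?thesis
          by (simp add: powr_mult[symmetric]) (simp add: powr_mult)
      qed
      have "U (Suc j) powr (2 / p) \<le> A * innerX a s (\<lambda>x. max 0 (u x - m)) (\<lambda>x. max 0 (u x - m))"
        using sob[OF excess_X[OF l1(1)[of "Suc j"]]] by (simp add: U_def m_def)
      also have "\<dots> \<le> A * (2 * C * (m / d) powr (q - 1) * d powr (q - p) * U j)"
        unfolding U_def d_def m_def using A
        by (intro mult_left_mono excess_energy_le[OF a \<open>open \<Omega>\<close> C q(1) qp growth weak]
            l1 l_less excess_int) auto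
      also have "\<dots> \<le> A * (2 * C * b powr p * (k powr (q - p) * b powr p) * U j)"
        using A C md dq U by (intro mult_left_mono mult_right_mono mult_mono) auto
      also have "\<dots> = A * 2 * C * (b powr p * b powr p) * k powr (q - p) * U j"
        by (simp only: mult_ac)
      also have "\<dots> = c * k powr (q - p) * (4 powr p) ^ j * U j"
        unfolding bb c_def by (simp only: mult_ac)
      finally have "U (Suc j) powr (2 / p) \<le> c * k powr (q - p) * (4 powr p) ^ j * U j" .
      \<comment> \<open>Solving for \<open>U (Suc j)\<close> puts the exponent
        \<open>p / 2 = 1 + \<delta>\<close> on \<open>U j\<close>, which exceeds 1.\<close>
      then have "(U (Suc j) powr (2 / p)) powr (p / 2) \<le> (c * k powr (q - p) * (4 powr p) ^ j * U j) powr (p / 2)"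
        using p by (intro powr_mono2) auto
      also have "\<dots> = (c * k powr (q - p)) powr (p / 2) * ((4 powr p) ^ j) powr (p / 2) * U j powr (p / 2)"
        by (simp only: powr_mult)
      also have "((4 powr p) ^ j) powr (p / 2) = D ^ j"
        by (simp add: D_def powr_realpow[symmetric] powr_powr mult_ac)
      finally show ?thesis using p U by (simp add: powr_powr \<delta>(2))
    qed
    have "U \<longlonglongrightarrow> 0"
    proof (rule fast_geometric_decay[OF U \<delta>(1) _ D step])
      have "(c * k powr (q - p)) powr (p / 2) * U 0 powr \<delta> * D powr (1 / \<delta>) =
          \<Theta> * k powr (p / 2 * (q - p)) * U 0 powr \<delta>"
        by (simp add: \<Theta>_def powr_mult powr_powr mult_ac)
      also have "\<dots> \<le> 1"
        using small by (simp add: U_def l_def)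
      finally show "(c * k powr (q - p)) powr (p / 2) * U 0 powr \<delta> * D powr (1 / \<delta>) \<le> 1" .
    qed simp
    \<comment> \<open>All levels are at most \<open>2 * k\<close>, so the excess over
      \<open>2 * k\<close> is bounded by every \<open>U j\<close>.\<close>
    moreover have "(\<integral>x. max 0 (u x - 2 * k) powr p \<partial>lborel) \<le> U j" for j
      unfolding U_def using k l1 p
      by (intro integral_mono excess_int powr_mono2 max.mono diff_mono order.refl) auto
    ultimately have "(\<integral>x. max 0 (u x - 2 * k) powr p \<partial>lborel) \<le> 0"
      by (intro LIMSEQ_le_const[of U]) auto
    moreover have "0 \<le> (\<integral>x. max 0 (u x - 2 * k) powr p \<partial>lborel)"
      by simp
    ultimately have "(\<integral>x. max 0 (u x - 2 * k) powr p \<partial>lborel) = 0"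
      by (rule antisym)
    then have "AE x in lborel. max 0 (u x - 2 * k) powr p = 0"
      using k excess_int[of "2 * k"] by (subst (asm) integral_nonneg_eq_0_iff_AE) auto
    then show ?thesis by eventually_elim (auto simp: max_def split: if_splits)
  qed
  moreover have "0 < \<Theta>" using c D by (simp add: \<Theta>_def)
  ultimately show thesis using that unfolding \<delta>_def by blast
qed

section \<open>Two-sided bounds\<close>

text \<open>Reflection turns upper bounds into lower bounds, the reflected nonlinearity having the
  same growth.\<close>

lemma weak_solution_uminus:
  assumes "weak_solution a s \<Omega> f u"
  shows "weak_solution a s \<Omega> (\<lambda>x t. - f x (- t)) (\<lambda>x. - u x)"
proof -
  have "innerX a s (\<lambda>x. - u x) v = - innerX a s u v" for v
  proof -
    have "innerX a s (\<lambda>x. - u x) v = (\<integral>p. - ((u (fst p) - u (snd p)) * (v (fst p) - v (snd p)) *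
        kernelK a s (fst p - snd p)) \<partial>(lborel \<Otimes>\<^sub>M lborel))"
      unfolding innerX_def by (intro Bochner_Integration.integral_cong) (auto simp: algebra_simps)
    then show ?thesis by (simp add: innerX_def)
  qed
  moreover have "(\<lambda>x. - u x) \<in> Xspace a s \<Omega>"
  proof -
    have "(- t - - t')\<^sup>2 = (t - t')\<^sup>2" for t t' :: real
      by (simp add: power2_eq_square algebra_simps)
    then show ?thesis
      using assms by (simp add: weak_solution_def Xspace_def)
  qed
  ultimately show ?thesis
    using assms by (simp add: weak_solution_def)
qed

lemma growth_bound_uminus:
  assumes "growth_bound \<Omega> f C q"
  shows "growth_bound \<Omega> (\<lambda>x t. - f x (- t)) C q"
  using assms unfolding growth_bound_def
  by eventually_elim (metis abs_minus_cancel)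

text \<open>The one-sided bound is applied to \<open>u\<close> and to its negative, whose excesses
  over \<open>k\<close> are both at most that of \<open>\<bar>u\<bar>\<close>.\<close>

lemma weak_solution_abs_le_of_small_excess:
  fixes \<Omega> :: "'a::euclidean_space set" and a :: "'a \<Rightarrow> real"
  assumes s: "0 < s" "2 * s < real DIM('a)" and "open \<Omega>" and a: "admissible_kernel a"
    and C: "0 < C" and q: "1 \<le> q" "q \<le> crit_exp DIM('a) s"
  defines "p \<equiv> crit_exp DIM('a) s"
  obtains \<Theta> where "0 < \<Theta>"
    "\<And>f u k. \<lbrakk>growth_bound \<Omega> f C q; weak_solution a s \<Omega> f u; 1 \<le> k;
      \<Theta> * k powr (p / 2 * (q - p)) * (\<integral>x. max 0 (\<bar>u x\<bar> - k) powr p \<partial>lborel) powr (p / 2 - 1) \<le> 1\<rbrakk>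
      \<Longrightarrow> AE x in lebesgue_on \<Omega>. \<bar>u x\<bar> \<le> 2 * k"
proof -
  obtain A where sob_int: "\<And>u. u \<in> Xspace a s \<Omega> \<Longrightarrow> integrable lborel (\<lambda>x. \<bar>u x\<bar> powr p)"
    using Xspace_sobolev[OF s a, where \<Omega> = \<Omega>] unfolding p_def by metis
  have p: "2 < p" using crit_exp_identities(1)[OF s] by (simp add: p_def)
  obtain \<Theta> where \<Theta>: "0 < \<Theta>" and main: "\<And>f u k. \<lbrakk>growth_bound \<Omega> f C q; weak_solution a s \<Omega> f u; 1 \<le> k;
      \<Theta> * k powr (p / 2 * (q - p)) * (\<integral>x. max 0 (u x - k) powr p \<partial>lborel) powr (p / 2 - 1) \<le> 1\<rbrakk>
      \<Longrightarrow> AE x in lborel. u x \<le> 2 * k"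
    using weak_solution_le_of_small_excess[OF s \<open>open \<Omega>\<close> a C q] unfolding p_def by metis
  have "AE x in lebesgue_on \<Omega>. \<bar>u x\<bar> \<le> 2 * k"
    if growth: "growth_bound \<Omega> f C q" and weak: "weak_solution a s \<Omega> f u" and k: "1 \<le> k"
      and small: "\<Theta> * k powr (p / 2 * (q - p)) *
        (\<integral>x. max 0 (\<bar>u x\<bar> - k) powr p \<partial>lborel) powr (p / 2 - 1) \<le> 1"
    for f u k
  proof -
    have u: "u \<in> Xspace a s \<Omega>" using weak by (simp add: weak_solution_def)
    note [measurable] = XspaceD(1)[OF u]
    have le: "\<Theta> * k powr (p / 2 * (q - p)) * (\<integral>x. max 0 (w x - k) powr p \<partial>lborel) powr (p / 2 - 1) \<le> 1"
      if [measurable]: "w \<in> borel_measurable borel" and w: "\<And>x. w x \<le> \<bar>u x\<bar>" for w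
    proof -
      have int: "integrable lborel (\<lambda>x. max 0 (v x - k) powr p)"
        if [measurable]: "v \<in> borel_measurable borel" and v: "\<And>x. v x \<le> \<bar>u x\<bar>" for v
      proof (rule Bochner_Integration.integrable_bound[OF sob_int[OF u]])
        have "max 0 (v x - k) powr p \<le> \<bar>u x\<bar> powr p" for x
          using p v[of x] k by (intro powr_mono2) auto
        then show "AE x in lborel. norm (max 0 (v x - k) powr p) \<le> norm (\<bar>u x\<bar> powr p)" by simp
      qed measurable
      have "(\<integral>x. max 0 (w x - k) powr p \<partial>lborel) \<le> (\<integral>x. max 0 (\<bar>u x\<bar> - k) powr p \<partial>lborel)"
        using p w by (intro integral_mono int powr_mono2 max.mono diff_mono) auto
      then have "(\<integral>x. max 0 (w x - k) powr p \<partial>lborel) powr (p / 2 - 1)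
          \<le> (\<integral>x. max 0 (\<bar>u x\<bar> - k) powr p \<partial>lborel) powr (p / 2 - 1)"
        using p by (intro powr_mono2) auto
      then have "\<Theta> * k powr (p / 2 * (q - p)) * (\<integral>x. max 0 (w x - k) powr p \<partial>lborel) powr (p / 2 - 1)
          \<le> \<Theta> * k powr (p / 2 * (q - p)) * (\<integral>x. max 0 (\<bar>u x\<bar> - k) powr p \<partial>lborel) powr (p / 2 - 1)"
        using \<Theta> by (intro mult_left_mono) auto
      with small show ?thesis by linarith
    qed
    have "AE x in lborel. u x \<le> 2 * k"
      by (rule main[OF growth weak k le]) auto
    moreover have "AE x in lborel. - u x \<le> 2 * k"
      by (rule main[OF growth_bound_uminus[OF growth] weak_solution_uminus[OF weak] k le]) auto
    ultimately have "AE x in lborel. \<bar>u x\<bar> \<le> 2 * k" by eventually_elim auto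
    then have "AE x in lebesgue. x \<in> \<Omega> \<longrightarrow> \<bar>u x\<bar> \<le> 2 * k"
      by (intro AE_completion) auto
    then show ?thesis
      using \<open>open \<Omega>\<close> by (subst AE_restrict_space_iff) auto
  qed
  with \<Theta> show thesis using that by blast
qed

section \<open>L^p norm on the domain and the critical and subcritical cases\<close>

text \<open>Since \<open>u\<close> vanishes almost everywhere outside the domain, integrating over
  the whole space changes nothing; this ties the norm in the final bound to integrals over
  \<open>lborel\<close>.\<close>

lemma Lp_norm_on_Xspace:
  assumes u: "u \<in> Xspace a s \<Omega>" and "open \<Omega>" and p: "0 < p"
  shows "Lp_norm_on \<Omega> p u powr p = (\<integral>x. \<bar>u x\<bar> powr p \<partial>lborel)"
proof -
  note [measurable] = XspaceD(1)[OF u]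
  have "(\<integral>x. \<bar>u x\<bar> powr p \<partial>lebesgue_on \<Omega>) = (\<integral>x. indicator \<Omega> x *\<^sub>R (\<bar>u x\<bar> powr p) \<partial>lebesgue)"
    using \<open>open \<Omega>\<close> by (subst integral_restrict_space) auto
  also have "\<dots> = (\<integral>x. indicator \<Omega> x *\<^sub>R (\<bar>u x\<bar> powr p) \<partial>lborel)"
    using \<open>open \<Omega>\<close> by (intro integral_completion) auto
  also have "\<dots> = (\<integral>x. \<bar>u x\<bar> powr p \<partial>lborel)"
  proof (rule integral_cong_AE)
    show "AE x in lborel. indicator \<Omega> x *\<^sub>R (\<bar>u x\<bar> powr p) = \<bar>u x\<bar> powr p"
      using XspaceD(4)[OF u] by eventually_elim (auto simp: indicator_def)
  qed (use \<open>open \<Omega>\<close> in auto)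
  finally show ?thesis
    using p by (simp add: Lp_norm_on_def powr_powr)
qed

theorem theorem4p1:
  fixes \<Omega> :: "'a::euclidean_space set" and a :: "'a \<Rightarrow> real" and s C q :: real
  assumes "0 < s" and "s < 1" and "2 * s < real DIM('a)"
    and "open \<Omega>" and "connected \<Omega>" and "bounded \<Omega>" and "C11_boundary \<Omega>"
    and "admissible_kernel a"
    and "C > 0" and "1 \<le> q" and "q \<le> crit_exp DIM('a) s"
  shows "(\<forall>f u. caratheodory \<Omega> f \<and> growth_bound \<Omega> f C q \<and> weak_solution a s \<Omega> f u
              \<longrightarrow> (\<exists>B. AE x in lebesgue_on \<Omega>. \<bar>u x\<bar> \<le> B))
       \<and> (q < crit_exp DIM('a) s \<longrightarrow>
           (\<exists>M :: real \<Rightarrow> real. continuous_on {0..} M \<and>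
              (\<forall>f u. caratheodory \<Omega> f \<and> growth_bound \<Omega> f C q \<and> weak_solution a s \<Omega> f u
                 \<longrightarrow> (AE x in lebesgue_on \<Omega>. \<bar>u x\<bar> \<le> M (Lp_norm_on \<Omega> (crit_exp DIM('a) s) u)))))"
proof -
  define p where "p = crit_exp DIM('a) s"
  have p: "2 < p" using crit_exp_identities(1)[OF assms(1,3)] by (simp add: p_def)
  have q: "1 \<le> q" "q \<le> p" using assms by (auto simp: p_def)
  obtain A where sob_int: "\<And>u. u \<in> Xspace a s \<Omega> \<Longrightarrow> integrable lborel (\<lambda>x. \<bar>u x\<bar> powr p)"
    using Xspace_sobolev[OF assms(1,3,8), where \<Omega> = \<Omega>] unfolding p_def by metis
  obtain \<Theta> where \<Theta>: "0 < \<Theta>" and main: "\<And>f u k. \<lbrakk>growth_bound \<Omega> f C q; weak_solution a s \<Omega> f u; 1 \<le> k;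
      \<Theta> * k powr (p / 2 * (q - p)) * (\<integral>x. max 0 (\<bar>u x\<bar> - k) powr p \<partial>lborel) powr (p / 2 - 1) \<le> 1\<rbrakk>
      \<Longrightarrow> AE x in lebesgue_on \<Omega>. \<bar>u x\<bar> \<le> 2 * k"
    using weak_solution_abs_le_of_small_excess[OF assms(1,3,4,8-11)] unfolding p_def by metis
  have excess_le: "max 0 (\<bar>u x\<bar> - k) powr p \<le> \<bar>u x\<bar> powr p" if "0 \<le> k" for u :: "'a \<Rightarrow> real" and x k
    using p that by (intro powr_mono2) auto
  have "\<exists>B. AE x in lebesgue_on \<Omega>. \<bar>u x\<bar> \<le> B"
    if growth: "growth_bound \<Omega> f C q" and weak: "weak_solution a s \<Omega> f u" for f u
  proof -
    have u: "u \<in> Xspace a s \<Omega>" using weak by (simp add: weak_solution_def)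
    note [measurable] = XspaceD(1)[OF u]
    \<comment> \<open>The excess tends to 0 by dominated convergence with majorant
      \<open>\<bar>u\<bar> powr p\<close>. This covers \<open>q = p\<close>, where the power of
      \<open>k\<close> gives no help; the threshold found depends on \<open>u\<close>
      itself.\<close>
    have "(\<lambda>k. \<integral>x. max 0 (\<bar>u x\<bar> - real k) powr p \<partial>lborel) \<longlonglongrightarrow> (\<integral>x. 0 \<partial>(lborel :: 'a measure))"
    proof (rule integral_dominated_convergence[OF _ _ sob_int[OF u]])
      show "AE x in lborel. (\<lambda>k. max 0 (\<bar>u x\<bar> - real k) powr p) \<longlonglongrightarrow> 0"
      proof (intro AE_I2 tendsto_eventually)
        fix x
        show "\<forall>\<^sub>F k in sequentially. max 0 (\<bar>u x\<bar> - real k) powr p = 0"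
          using eventually_ge_at_top[of "nat \<lceil>\<bar>u x\<bar>\<rceil>"]
        proof eventually_elim
          case (elim k)
          then have "\<bar>u x\<bar> \<le> real k" by linarith
          then show ?case by (simp add: max_def)
        qed
      qed
    qed (auto simp: excess_le)
    then have "(\<lambda>k. \<Theta> * (\<integral>x. max 0 (\<bar>u x\<bar> - real k) powr p \<partial>lborel) powr (p / 2 - 1)) \<longlonglongrightarrow> \<Theta> * 0 powr (p / 2 - 1)"
      using p by (intro tendsto_intros tendsto_powr') auto
    then have "\<forall>\<^sub>F k in sequentially. \<Theta> * (\<integral>x. max 0 (\<bar>u x\<bar> - real k) powr p \<partial>lborel) powr (p / 2 - 1) < 1"
      by (rule order_tendstoD) simp
    then have "\<forall>\<^sub>F k in sequentially. 1 \<le> k \<and>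
        \<Theta> * (\<integral>x. max 0 (\<bar>u x\<bar> - real k) powr p \<partial>lborel) powr (p / 2 - 1) < 1"
      using eventually_ge_at_top[of 1] by eventually_elim auto
    then obtain k :: nat where k: "1 \<le> k"
      "\<Theta> * (\<integral>x. max 0 (\<bar>u x\<bar> - real k) powr p \<partial>lborel) powr (p / 2 - 1) < 1"
      by (auto simp: eventually_sequentially)
    \<comment> \<open>The exponent is at most 0 and \<open>k \<ge> 1\<close>, so the power of
      \<open>k\<close> does no harm.\<close>
    have "real k powr (p / 2 * (q - p)) \<le> real k powr 0"
      using k p q by (intro powr_mono mult_nonneg_nonpos) auto
    then have "real k powr (p / 2 * (q - p)) *
        (\<Theta> * (\<integral>x. max 0 (\<bar>u x\<bar> - real k) powr p \<partial>lborel) powr (p / 2 - 1)) \<le> 1 * 1"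
      using k \<Theta> by (intro mult_mono) auto
    then have "AE x in lebesgue_on \<Omega>. \<bar>u x\<bar> \<le> 2 * real k"
      using k by (intro main[OF growth weak]) (auto simp: mult_ac)
    then show ?thesis by blast
  qed
  moreover have "\<exists>M :: real \<Rightarrow> real. continuous_on {0..} M \<and>
      (\<forall>f u. caratheodory \<Omega> f \<and> growth_bound \<Omega> f C q \<and> weak_solution a s \<Omega> f u
        \<longrightarrow> (AE x in lebesgue_on \<Omega>. \<bar>u x\<bar> \<le> M (Lp_norm_on \<Omega> p u)))"
    if "q < p"
  proof -
    define e where "e = p / 2 * (p - q)"
    have e: "0 < e" using p that by (simp add: e_def)
    \<comment> \<open>The smallness condition asks for
      \<open>k powr e \<ge> \<Theta> * U powr (p / 2 - 1)\<close>, and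
      \<open>U \<le> N powr p\<close>, so the second summand alone is large enough. The summand 1
      secures \<open>k N \<ge> 1\<close>.\<close>
    define k where "k N = 1 + (\<Theta> * N powr (p * (p / 2 - 1))) powr (1 / e)" for N :: real
    \<comment> \<open>Both exponents are positive, so \<open>powr\<close> is continuous up to
      \<open>N = 0\<close>.\<close>
    have "continuous_on {0..} (\<lambda>N. 2 * k N)"
      unfolding k_def using p e \<Theta> by (intro continuous_intros continuous_on_powr') auto
    moreover have "AE x in lebesgue_on \<Omega>. \<bar>u x\<bar> \<le> 2 * k (Lp_norm_on \<Omega> p u)"
      if growth: "growth_bound \<Omega> f C q" and weak: "weak_solution a s \<Omega> f u" for f u
    proof (rule main[OF growth weak])
      have u: "u \<in> Xspace a s \<Omega>" using weak by (simp add: weak_solution_def)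
      note [measurable] = XspaceD(1)[OF u]
      define N where "N = Lp_norm_on \<Omega> p u"
      define U where "U = (\<integral>x. max 0 (\<bar>u x\<bar> - k N) powr p \<partial>lborel)"
      show k1: "1 \<le> k (Lp_norm_on \<Omega> p u)" by (simp add: k_def)
      have k0: "0 \<le> k N" "0 < k N" by (simp_all add: k_def add_pos_nonneg)
      have "U \<le> (\<integral>x. \<bar>u x\<bar> powr p \<partial>lborel)"
        unfolding U_def
      proof (rule integral_mono)
        show "integrable lborel (\<lambda>x. max 0 (\<bar>u x\<bar> - k N) powr p)"
          by (rule Bochner_Integration.integrable_bound[OF sob_int[OF u]])
            (auto simp: excess_le k0)
      qed (auto simp: sob_int[OF u] excess_le k0)
      also have "\<dots> = N powr p"
        unfolding N_def using p \<open>open \<Omega>\<close> by (intro Lp_norm_on_Xspace[symmetric, OF u]) auto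
      finally have "U powr (p / 2 - 1) \<le> (N powr p) powr (p / 2 - 1)"
        using p by (intro powr_mono2) (auto simp: U_def)
      then have "\<Theta> * U powr (p / 2 - 1) \<le> \<Theta> * N powr (p * (p / 2 - 1))"
        using \<Theta> by (simp add: powr_powr)
      also have "\<dots> = ((\<Theta> * N powr (p * (p / 2 - 1))) powr (1 / e)) powr e"
        using e \<Theta> by (simp add: powr_powr)
      also have "\<dots> \<le> k N powr e"
        using e by (intro powr_mono2) (auto simp: k_def)
      finally have "\<Theta> * U powr (p / 2 - 1) \<le> k N powr e" .
      moreover have "k N powr (p / 2 * (q - p)) = 1 / k N powr e"
        unfolding powr_minus_divide[symmetric] e_def
        by (simp add: minus_diff_eq[symmetric, of p q] del: minus_diff_eq)
      ultimately show "\<Theta> * k (Lp_norm_on \<Omega> p u) powr (p / 2 * (q - p)) *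
          (\<integral>x. max 0 (\<bar>u x\<bar> - k (Lp_norm_on \<Omega> p u)) powr p \<partial>lborel) powr (p / 2 - 1) \<le> 1"
        unfolding N_def[symmetric] U_def[symmetric] using k0 by (simp add: divide_le_eq)
    qed
    ultimately show ?thesis by blast
  qed
  ultimately show ?thesis
    unfolding p_def[symmetric] by blast
qed

end
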